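(* Let $A$ be an affine generalized Cartan matrix. Each connected component of the poset $(\Lambda^+,\leqslant)$ of dominant integral weights of $\mathfrak{g}(A)$ is a lattice.
   Context: $A=(a_{ij})_{0\le i,j\le n}$ is an affine generalized Cartan matrix, $\mathfrak{g}(A)$ its Kac-Moody algebra with Cartan subalgebra $\mathfrak{h}$, simple roots $\alpha_0,\dots,\alpha_n$ and simple coroots $\alpha_0^\vee,\dots,\alpha_n^\vee$, with $\alpha_j(\alpha_i^\vee)=a_{ij}$. $\Lambda^+=\{\lambda\in\mathfrak{h}^*:\lambda(\alpha_i^\vee)\in\mathbb{Z}_{\ge0}\text{ for all }0\le i\le n\}$ is the set of dominant integral weights, partially ordered by: $\mu\leqslant\lambda$ iff $\lambda-\mu$ is a non-negative integral sum of simple roots. Connected components are the classes of the equivalence relation generated by comparability. A lattice is a poset in which every pair of elements has a greatest lower bound and a least upper bound. *)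

theory Defs
  imports "HOL-Analysis.Cartesian_Space" "HOL-Library.FuncSet" "HOL-Algebra.Lattice"
begin

section \<open>Affine generalized Cartan matrices\<close>

text \<open>
  Matrices are indexed by a finite type, which plays the role of the index set \<open>{0, \<dots>, n}\<close>;
  thus \<open>n + 1\<close> is \<open>CARD('i)\<close>.
\<close>

definition generalized_cartan_matrix :: "int ^ 'i ^ 'i \<Rightarrow> bool" where
  "generalized_cartan_matrix A \<longleftrightarrow>
     (\<forall>i. A $ i $ i = 2) \<and>
     (\<forall>i j. i \<noteq> j \<longrightarrow> A $ i $ j \<le> 0) \<and>
     (\<forall>i j. A $ i $ j = 0 \<longrightarrow> A $ j $ i = 0)"

definition indecomposable :: "int ^ 'i ^ 'i \<Rightarrow> bool" where
  "indecomposable A \<longleftrightarrow>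
     \<not> (\<exists>S. S \<noteq> {} \<and> S \<noteq> UNIV \<and>
          (\<forall>i\<in>S. \<forall>j\<in>- S. A $ i $ j = 0 \<and> A $ j $ i = 0))"

abbreviation real_matrix :: "int ^ 'i ^ 'i \<Rightarrow> real ^ 'i ^ 'i" where
  "real_matrix A \<equiv> map_matrix real_of_int A"

text \<open>
  The affine case of Kac's trichotomy (finite, affine, indefinite) for indecomposable matrices:
  corank one, a strictly positive null vector, and no \<open>v\<close> with \<open>A v\<close> nonnegative and nonzero.
\<close>

definition affine_type :: "int ^ 'i ^ 'i \<Rightarrow> bool" where
  "affine_type A \<longleftrightarrow>
     rank (real_matrix A) + 1 = CARD('i) \<and>
     (\<exists>u. (\<forall>i. 0 < u $ i) \<and> real_matrix A *v u = 0) \<and>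
     (\<forall>v. (\<forall>i. 0 \<le> (real_matrix A *v v) $ i) \<longrightarrow> real_matrix A *v v = 0)"

definition affine_gcm :: "int ^ 'i ^ 'i \<Rightarrow> bool" where
  "affine_gcm A \<longleftrightarrow> generalized_cartan_matrix A \<and> indecomposable A \<and> affine_type A"

section \<open>Kac--Moody algebras\<close>

text \<open>
  The dual of a subspace \<open>H\<close>. Functionals are only meaningful on \<open>H\<close>; extensionality makes
  equality of functions coincide with equality of functionals on \<open>H\<close>.
\<close>

definition linear_dual ::
    "(complex \<Rightarrow> 'g \<Rightarrow> 'g) \<Rightarrow> 'g :: ab_group_add set \<Rightarrow> ('g \<Rightarrow> complex) set" where
  "linear_dual scaleC H =
     {\<phi> \<in> extensional H.
        (\<forall>x\<in>H. \<forall>y\<in>H. \<phi> (x + y) = \<phi> x + \<phi> y) \<and>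
        (\<forall>c. \<forall>x\<in>H. \<phi> (scaleC c x) = c * \<phi> x)}"

locale complex_lie_algebra = vector_space scaleC
  for scaleC :: "complex \<Rightarrow> 'g :: ab_group_add \<Rightarrow> 'g" +
  fixes bracket :: "'g \<Rightarrow> 'g \<Rightarrow> 'g"
  assumes linear_right: "Vector_Spaces.linear scaleC scaleC (bracket x)"
    and linear_left: "Vector_Spaces.linear scaleC scaleC (\<lambda>x. bracket x y)"
    and alternating: "bracket x x = 0"
    and jacobi: "bracket x (bracket y z) + bracket y (bracket z x) + bracket z (bracket x y) = 0"
begin

definition lie_subalgebra :: "'g set \<Rightarrow> bool" where
  "lie_subalgebra S \<longleftrightarrow> subspace S \<and> (\<forall>x\<in>S. \<forall>y\<in>S. bracket x y \<in> S)"

definition lie_ideal :: "'g set \<Rightarrow> bool" where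
  "lie_ideal I \<longleftrightarrow> subspace I \<and> (\<forall>x. \<forall>y\<in>I. bracket x y \<in> I)"

end

text \<open>
  The Kac--Moody algebra \<open>\<gg>(A)\<close> over the complex numbers is the Lie algebra with the
  generators and relations below, divided by its largest ideal meeting the Cartan subalgebra
  trivially. It is given here by the properties that determine it, together with its Cartan
  subalgebra, simple roots and simple coroots, up to isomorphism (V. Kac, Infinite Dimensional
  Lie Algebras, Proposition 1.4): \<open>(H, simple_root, simple_coroot)\<close> is a realization of
  \<open>A\<close>, the defining relations hold, \<open>H\<close>, \<open>e\<close> and \<open>f\<close> generate, and no nonzero ideal
  meets \<open>H\<close> trivially. Finite dimensionality of \<open>H\<close> follows from \<open>dim_cartan\<close>,
  since its dimension is positive and \<open>dim\<close> is zero on infinite-dimensional spaces.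
\<close>

locale kac_moody_algebra = complex_lie_algebra scaleC bracket
  for A :: "int ^ 'i ^ 'i"
    and scaleC :: "complex \<Rightarrow> 'g :: ab_group_add \<Rightarrow> 'g"
    and bracket :: "'g \<Rightarrow> 'g \<Rightarrow> 'g" +
  fixes H :: "'g set"
    and simple_root :: "'i \<Rightarrow> 'g \<Rightarrow> complex"
    and simple_coroot :: "'i \<Rightarrow> 'g"
    and e f :: "'i \<Rightarrow> 'g"
  assumes gcm: "generalized_cartan_matrix A"
    and subspace_cartan: "subspace H"
    and dim_cartan: "dim H + rank (real_matrix A) = 2 * CARD('i)"
    and coroot_in_cartan: "simple_coroot i \<in> H"
    and coroots_independent: "inj simple_coroot" "independent (range simple_coroot)"
    and root_in_dual: "simple_root i \<in> linear_dual scaleC H"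
    and roots_independent:
      "(\<forall>x\<in>H. (\<Sum>i\<in>UNIV. c i * simple_root i x) = 0) \<Longrightarrow> c i = 0"
    and root_coroot: "simple_root j (simple_coroot i) = of_int (A $ i $ j)"
    and bracket_cartan: "x \<in> H \<Longrightarrow> y \<in> H \<Longrightarrow> bracket x y = 0"
    and bracket_e_f: "bracket (e i) (f j) = (if i = j then simple_coroot i else 0)"
    and bracket_cartan_e: "x \<in> H \<Longrightarrow> bracket x (e i) = scaleC (simple_root i x) (e i)"
    and bracket_cartan_f: "x \<in> H \<Longrightarrow> bracket x (f i) = scaleC (- simple_root i x) (f i)"
    and generated:
      "lie_subalgebra S \<Longrightarrow> H \<union> range e \<union> range f \<subseteq> S \<Longrightarrow> S = UNIV"
    and no_ideals: "lie_ideal I \<Longrightarrow> I \<inter> H = {0} \<Longrightarrow> I = {0}"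

section \<open>The poset of dominant integral weights\<close>

definition dominant_weights ::
    "(complex \<Rightarrow> 'g \<Rightarrow> 'g) \<Rightarrow> 'g :: ab_group_add set \<Rightarrow> ('i \<Rightarrow> 'g) \<Rightarrow> ('g \<Rightarrow> complex) set" where
  "dominant_weights scaleC H simple_coroot =
     {\<mu> \<in> linear_dual scaleC H. \<forall>i. \<mu> (simple_coroot i) \<in> \<nat>}"

definition root_le ::
    "'g set \<Rightarrow> ('i :: finite \<Rightarrow> 'g \<Rightarrow> complex) \<Rightarrow> ('g \<Rightarrow> complex) \<Rightarrow> ('g \<Rightarrow> complex) \<Rightarrow> bool" where
  "root_le H simple_root \<mu> \<nu> \<longleftrightarrow>
     (\<exists>k :: 'i \<Rightarrow> nat. \<forall>x\<in>H. \<nu> x - \<mu> x = (\<Sum>i\<in>UNIV. of_nat (k i) * simple_root i x))"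

definition dominance_poset ::
    "(complex \<Rightarrow> 'g \<Rightarrow> 'g) \<Rightarrow> 'g :: ab_group_add set \<Rightarrow> ('i :: finite \<Rightarrow> 'g \<Rightarrow> complex) \<Rightarrow>
     ('i \<Rightarrow> 'g) \<Rightarrow> ('g \<Rightarrow> complex) gorder" where
  "dominance_poset scaleC H simple_root simple_coroot =
     \<lparr>carrier = dominant_weights scaleC H simple_coroot, eq = (=), le = root_le H simple_root\<rparr>"

definition comparability :: "('a, 'm) gorder_scheme \<Rightarrow> ('a \<times> 'a) set" where
  "comparability L =
     {(x, y). x \<in> carrier L \<and> y \<in> carrier L \<and> (x \<sqsubseteq>\<^bsub>L\<^esub> y \<or> y \<sqsubseteq>\<^bsub>L\<^esub> x)}"

text \<open>
  Comparability in a poset is reflexive and symmetric on the carrier, so its transitive closure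
  is the equivalence relation it generates.
\<close>

definition connected_components :: "('a, 'm) gorder_scheme \<Rightarrow> 'a set set" where
  "connected_components L = carrier L // (comparability L)\<^sup>+"

lemma equiv_comparability:
  assumes "weak_partial_order L"
  shows "equiv (carrier L) ((comparability L)\<^sup>+)"
proof (rule equivI)
  have sub: "comparability L \<subseteq> carrier L \<times> carrier L"
    by (auto simp: comparability_def)
  then show "(comparability L)\<^sup>+ \<subseteq> carrier L \<times> carrier L"
    by (rule trancl_subset_Sigma)
  have "(x, x) \<in> comparability L" if "x \<in> carrier L" for x
    using that weak_partial_order.le_refl[OF assms that] by (simp add: comparability_def)
  then show "refl_on (carrier L) ((comparability L)\<^sup>+)"
    by (auto simp: refl_on_def)
  show "sym ((comparability L)\<^sup>+)"
    by (rule sym_trancl) (auto simp: sym_def comparability_def)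
  show "trans ((comparability L)\<^sup>+)"
    by (rule trans_trancl)
qed

end

theory Submission
  imports Defs
begin

text \<open>
  Fix a dominant weight \<open>\<kappa>\<close> and describe the weights \<open>\<kappa> + \<Sum> z\<^sub>j \<alpha>\<^sub>j\<close> in its root lattice coset by
  their integer coordinates \<open>z\<close>; since the simple roots are independent, \<open>\<leqslant>\<close> becomes the pointwise
  order. As the off-diagonal entries of \<open>A\<close> are nonpositive, the pointwise minimum of two dominant
  points is dominant. This gives meets, and shows that a component is the set of all dominant
  weights in a coset. In affine type a positive integral null vector \<open>\<delta>\<close> exists, and adding a large
  multiple of \<open>\<delta>\<close> to one of two weights yields a dominant upper bound of both; a dominant upper bound
  with minimal coordinate sum is then the join, by closure under minima.
\<close>

section \<open>Dominant points of a root lattice coset in integer coordinates\<close>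

definition dominant_points :: "int ^ 'i ^ 'i \<Rightarrow> ('i \<Rightarrow> int) \<Rightarrow> ('i \<Rightarrow> int) set" where
  "dominant_points A b = {z. \<forall>i. 0 \<le> b i + (\<Sum>j\<in>UNIV. A $ i $ j * z j)}"

text \<open>In row \<open>i\<close>, start from whichever point has the smaller \<open>i\<close>-th
  coordinate. Passing to the infimum keeps that coordinate and can only lower the others, whose
  coefficients are nonpositive, so the row sum does not drop.\<close>

lemma inf_dominant_points:
  fixes A :: "int ^ 'i ^ 'i"
  assumes gcm: "generalized_cartan_matrix A"
    and z: "z \<in> dominant_points A b" and w: "w \<in> dominant_points A b"
  shows "inf z w \<in> dominant_points A b"
  unfolding dominant_points_def
proof (intro CollectI allI)
  fix i
  have step: "0 \<le> b i + (\<Sum>j\<in>UNIV. A $ i $ j * inf x y j)"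
    if "x \<in> dominant_points A b" and le: "x i \<le> y i" for x y
  proof -
    have "A $ i $ j * x j \<le> A $ i $ j * inf x y j" for j
    proof (cases "j = i")
      case True
      then show ?thesis using le by (simp add: inf_absorb1)
    next
      case False
      then have "A $ i $ j \<le> 0"
        using gcm unfolding generalized_cartan_matrix_def by metis
      then show ?thesis by (intro mult_left_mono_neg) (auto simp: inf_fun_def)
    qed
    then have "(\<Sum>j\<in>UNIV. A $ i $ j * x j) \<le> (\<Sum>j\<in>UNIV. A $ i $ j * inf x y j)"
      by (intro sum_mono)
    moreover have "0 \<le> b i + (\<Sum>j\<in>UNIV. A $ i $ j * x j)"
      using that(1) by (simp add: dominant_points_def)
    ultimately show ?thesis by linarith
  qed
  show "0 \<le> b i + (\<Sum>j\<in>UNIV. A $ i $ j * inf z w j)"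
  proof (cases "z i \<le> w i")
    case True
    then show ?thesis using step[OF z] by blast
  next
    case False
    then show ?thesis using step[OF w, of z] by (simp add: inf.commute)
  qed
qed

text \<open>
  A real null vector \<open>u\<close> is made integral by pigeonhole: \<open>A\<close> maps the floors of \<open>t u\<close>,
  for natural \<open>t\<close>, to a bounded set of integer vectors.
\<close>

lemma integral_null_vector:
  fixes A :: "int ^ 'i ^ 'i"
  assumes pos: "\<And>i. 0 < u $ i" and null: "real_matrix A *v u = 0"
  obtains d :: "'i \<Rightarrow> int" where "\<And>j. 0 < d j" "\<And>i. (\<Sum>j\<in>UNIV. A $ i $ j * d j) = 0"
proof -
  define F where "F t i = (\<Sum>j\<in>UNIV. A $ i $ j * \<lfloor>real t * u $ j\<rfloor>)" for t :: nat and i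
  define M where "M i = (\<Sum>j\<in>UNIV. \<bar>A $ i $ j\<bar>)" for i
  have null': "(\<Sum>j\<in>UNIV. real_of_int (A $ i $ j) * u $ j) = 0" for i
    using arg_cong[OF null, of "\<lambda>x. x $ i"]
    by (simp add: matrix_vector_mult_def map_matrix_def)
  \<comment> \<open>Since \<open>A\<close> kills \<open>t u\<close>, the vector \<open>F t\<close>
    is minus the image under \<open>A\<close> of the fractional parts of \<open>t u\<close>. These
    lie in [0,1), which gives a bound independent of \<open>t\<close>.\<close>
  have "\<bar>F t i\<bar> \<le> M i" for t i
  proof -
    have "real_of_int (F t i)
        = (\<Sum>j\<in>UNIV. real_of_int (A $ i $ j) * (real t * u $ j))
          - (\<Sum>j\<in>UNIV. real_of_int (A $ i $ j) * frac (real t * u $ j))"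
      by (simp add: F_def frac_def algebra_simps sum_subtractf)
    also have "(\<Sum>j\<in>UNIV. real_of_int (A $ i $ j) * (real t * u $ j))
        = real t * (\<Sum>j\<in>UNIV. real_of_int (A $ i $ j) * u $ j)"
      by (simp add: sum_distrib_left algebra_simps)
    finally have "\<bar>real_of_int (F t i)\<bar>
        = \<bar>\<Sum>j\<in>UNIV. real_of_int (A $ i $ j) * frac (real t * u $ j)\<bar>"
      by (simp add: null')
    also have "\<dots> \<le> (\<Sum>j\<in>UNIV. \<bar>real_of_int (A $ i $ j)\<bar> * 1)"
      by (rule order_trans[OF sum_abs], intro sum_mono, unfold abs_mult, intro mult_left_mono)
        (auto simp: frac_lt_1 less_imp_le)
    also have "\<dots> = real_of_int (M i)"
      by (simp add: M_def)
    finally show ?thesis by linarith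
  qed
  then have "range F \<subseteq> (\<Pi>\<^sub>E i\<in>UNIV. {- M i..M i})"
    by (auto simp: abs_le_iff minus_le_iff)
  then have "finite (range F)"
    by (rule finite_subset) (auto intro: finite_PiE)
  then obtain s where inf: "infinite {t. F t = F s}"
    using pigeonhole_infinite[of "UNIV :: nat set" F] by auto
  \<comment> \<open>Raising \<open>t\<close> by at least \<open>N\<close> raises every floor
    strictly. Phrased with "eventually", finitely many coordinates share one such
    \<open>N\<close>.\<close>
  obtain N :: nat where N: "\<And>j. 1 < real N * u $ j"
  proof -
    have "\<exists>n. \<forall>j. 1 < real n * u $ j"
    proof -
      have "\<forall>\<^sub>F n in sequentially. 1 < real n * u $ j" for j
      proof -
        obtain n0 :: nat where n0: "1 < real n0 * u $ j"
          using ex_less_of_nat_mult[OF pos] by blast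
        show ?thesis
          by (rule eventually_sequentiallyI[of n0])
            (use n0 pos[of j] in \<open>meson less_le_trans less_imp_le mult_right_mono of_nat_mono\<close>)
      qed
      then have "\<forall>\<^sub>F n in sequentially. \<forall>j. 1 < real n * u $ j"
        by (intro eventually_all_finite)
      then show ?thesis by (auto simp: eventually_sequentially)
    qed
    then show thesis using that by blast
  qed
  obtain t where t: "F t = F s" "s + N \<le> t"
    using inf unfolding infinite_nat_iff_unbounded_le by blast
  \<comment> \<open>The witness is the difference of the floors at \<open>t\<close> and at
    \<open>s\<close>: \<open>A\<close> maps both to the same vector, and the gap \<open>N\<close>
    makes the difference positive.\<close>
  show thesis
  proof
    fix j
    have "real s * u $ j + 1 < real s * u $ j + real N * u $ j"
      using N by simp
    also have "\<dots> = real (s + N) * u $ j"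
      by (simp add: algebra_simps)
    also have "\<dots> \<le> real t * u $ j"
      using t(2) pos[of j] by (intro mult_right_mono) auto
    finally show "0 < \<lfloor>real t * u $ j\<rfloor> - \<lfloor>real s * u $ j\<rfloor>"
      by linarith
  next
    show "(\<Sum>j\<in>UNIV. A $ i $ j * (\<lfloor>real t * u $ j\<rfloor> - \<lfloor>real s * u $ j\<rfloor>)) = 0" for i
      using fun_cong[OF t(1), of i] by (simp add: F_def algebra_simps sum_subtractf)
  qed
qed

lemma dominant_points_upper_bound:
  fixes A :: "int ^ 'i ^ 'i"
  assumes affine: "affine_gcm A" and z: "z \<in> dominant_points A b"
  obtains s where "s \<in> dominant_points A b" "z \<le> s" "w \<le> s"
proof -
  obtain u where "\<And>i. 0 < u $ i" "real_matrix A *v u = 0"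
    using affine unfolding affine_gcm_def affine_type_def by blast
  then obtain d where d: "\<And>j. 0 < d j" "\<And>i. (\<Sum>j\<in>UNIV. A $ i $ j * d j) = 0"
    by (rule integral_null_vector) blast
  \<comment> \<open>This \<open>m\<close> bounds every coordinate of \<open>w - z\<close>. As each
    \<open>d j\<close> is at least 1, moving \<open>z\<close> by \<open>m\<close> times
    \<open>d\<close> passes \<open>w\<close>, and the row sums do not change because
    \<open>d\<close> is a null vector.\<close>
  define m where "m = (\<Sum>j\<in>UNIV. \<bar>w j - z j\<bar>)"
  have m: "0 \<le> m" "\<bar>w j - z j\<bar> \<le> m" for j
    unfolding m_def by (auto intro: sum_nonneg member_le_sum)
  show thesis
  proof
    have "(\<Sum>j\<in>UNIV. A $ i $ j * (z j + m * d j))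
        = (\<Sum>j\<in>UNIV. A $ i $ j * z j) + m * (\<Sum>j\<in>UNIV. A $ i $ j * d j)" for i
      by (simp add: sum.distrib sum_distrib_left algebra_simps)
    then show "(\<lambda>j. z j + m * d j) \<in> dominant_points A b"
      using z by (simp add: dominant_points_def d)
    show "z \<le> (\<lambda>j. z j + m * d j)"
      using m(1) d(1) by (simp add: le_fun_def less_imp_le)
    have "w j \<le> z j + m * d j" for j
    proof -
      have "m * 1 \<le> m * d j"
        using m(1) d(1)[of j] by (intro mult_left_mono) auto
      then show ?thesis using m(2)[of j] by linarith
    qed
    then show "w \<le> (\<lambda>j. z j + m * d j)"
      by (simp add: le_fun_def)
  qed
qed

lemma dominant_points_join:
  fixes A :: "int ^ 'i ^ 'i"
  assumes affine: "affine_gcm A" and z: "z \<in> dominant_points A b"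
  obtains s where "s \<in> dominant_points A b" "z \<le> s" "w \<le> s"
    "\<And>t. t \<in> dominant_points A b \<Longrightarrow> z \<le> t \<Longrightarrow> w \<le> t \<Longrightarrow> s \<le> t"
proof -
  define U where "U s \<longleftrightarrow> s \<in> dominant_points A b \<and> z \<le> s \<and> w \<le> s" for s
  \<comment> \<open>Measuring from \<open>z\<close> makes the sum nonnegative on \<open>U\<close>,
    so \<open>nat\<close> loses nothing there and a minimum exists.\<close>
  define h where "h s = nat (\<Sum>j\<in>UNIV. s j - z j)" for s
  obtain s0 where "U s0"
    using dominant_points_upper_bound[OF affine z] unfolding U_def by metis
  then obtain s where s: "U s" and min: "\<And>t. U t \<Longrightarrow> h s \<le> h t"
    using ex_has_least_nat[of U s0 h] by blast
  show thesis
  proof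
    fix t assume "t \<in> dominant_points A b" "z \<le> t" "w \<le> t"
    then have inf: "U (inf s t)"
      using s inf_dominant_points[of A s b t] affine by (simp add: U_def affine_gcm_def)
    have nonneg: "0 \<le> (\<Sum>j\<in>UNIV. x j - z j)" if "U x" for x
      using that by (intro sum_nonneg) (auto simp: U_def le_fun_def)
    \<comment> \<open>By minimality \<open>s\<close> and \<open>inf s t\<close> have the same
      coordinate sum. As one lies below the other, they coincide.\<close>
    have "(\<Sum>j\<in>UNIV. s j - z j) \<le> (\<Sum>j\<in>UNIV. inf s t j - z j)"
      using min[OF inf] nonneg[OF inf] by (simp add: h_def)
    moreover have "(\<Sum>j\<in>UNIV. inf s t j - z j) \<le> (\<Sum>j\<in>UNIV. s j - z j)"
      by (intro sum_mono) simp
    ultimately have "(\<Sum>j\<in>UNIV. s j - inf s t j) = 0"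
      by (simp add: sum_subtractf)
    then have "s j = inf s t j" for j
      by (subst (asm) sum_nonneg_eq_0_iff) auto
    then show "s \<le> t"
      by (metis inf.absorb_iff1 ext)
  qed (use s in \<open>auto simp: U_def\<close>)
qed

section \<open>Weights of the Kac-Moody algebra and their coordinates\<close>

context kac_moody_algebra
begin

abbreviation "dominance \<equiv> dominance_poset scaleC H simple_root simple_coroot"

text \<open>Restriction to \<open>H\<close> keeps the result extensional, as
  \<open>linear_dual\<close> demands.\<close>

definition root_shift :: "('g \<Rightarrow> complex) \<Rightarrow> ('i \<Rightarrow> int) \<Rightarrow> 'g \<Rightarrow> complex" where
  "root_shift \<kappa> z = (\<lambda>x\<in>H. \<kappa> x + (\<Sum>j\<in>UNIV. of_int (z j) * simple_root j x))"

lemma root_shift_dual: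
  assumes "\<kappa> \<in> linear_dual scaleC H"
  shows "root_shift \<kappa> z \<in> linear_dual scaleC H"
proof -
  have "simple_root j (x + y) = simple_root j x + simple_root j y"
    "simple_root j (scaleC c x) = c * simple_root j x" if "x \<in> H" "y \<in> H" for j x y c
    using root_in_dual[of j] that by (auto simp: linear_dual_def)
  then show ?thesis
    using assms subspace_add[OF subspace_cartan] subspace_scale[OF subspace_cartan]
    by (auto simp: linear_dual_def root_shift_def sum.distrib sum_distrib_left algebra_simps)
qed

text \<open>The shift by \<open>z\<close> adds the \<open>i\<close>-th entry of \<open>A z\<close>
  to the pairing with the \<open>i\<close>-th simple coroot, and \<open>b\<close> records the
  pairings of \<kappa> itself.\<close>

lemma root_shift_dominant_iff:
  assumes "\<kappa> \<in> linear_dual scaleC H" and b: "\<And>i. \<kappa> (simple_coroot i) = of_int (b i)"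
  shows "root_shift \<kappa> z \<in> dominant_weights scaleC H simple_coroot \<longleftrightarrow> z \<in> dominant_points A b"
proof -
  have "root_shift \<kappa> z (simple_coroot i) = of_int (b i + (\<Sum>j\<in>UNIV. A $ i $ j * z j))" for i
    by (simp add: root_shift_def coroot_in_cartan b root_coroot mult.commute)
  moreover have "(of_int k :: complex) \<in> \<nat> \<longleftrightarrow> 0 \<le> k" for k
    by (metis Nats_cases nonneg_int_cases of_int_eq_iff of_int_of_nat_eq of_nat_0_le_iff of_nat_in_Nats)
  ultimately show ?thesis
    using root_shift_dual[OF assms(1)]
    by (simp add: dominant_weights_def dominant_points_def del: of_int_add of_int_sum)
qed

lemma root_le_root_shift_iff:
  "root_le H simple_root (root_shift \<kappa> z) (root_shift \<kappa> w) \<longleftrightarrow> z \<le> w"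
proof
  assume "root_le H simple_root (root_shift \<kappa> z) (root_shift \<kappa> w)"
  then obtain k :: "'i \<Rightarrow> nat" where k: "\<And>x. x \<in> H \<Longrightarrow>
      root_shift \<kappa> w x - root_shift \<kappa> z x = (\<Sum>i\<in>UNIV. of_nat (k i) * simple_root i x)"
    unfolding root_le_def by blast
  \<comment> \<open>Two expansions of the same functional in the simple roots are subtracted, so
    that independence identifies the natural coefficients \<open>k\<close> with
    \<open>w - z\<close>.\<close>
  have "\<forall>x\<in>H. (\<Sum>i\<in>UNIV. of_int (w i - z i - int (k i)) * simple_root i x) = 0"
    using k by (simp add: root_shift_def sum_subtractf left_diff_distrib)
  then have "of_int (w i - z i - int (k i)) = (0 :: complex)" for i
    by (rule roots_independent)
  then have "w i - z i = int (k i)" for i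
    by (metis eq_iff_diff_eq_0 of_int_eq_0_iff)
  then show "z \<le> w"
    by (metis diff_ge_0_iff_ge le_fun_def of_nat_0_le_iff)
next
  assume "z \<le> w"
  then have "of_nat (nat (w i - z i)) = (of_int (w i - z i) :: complex)" for i
    by (simp add: le_fun_def)
  then show "root_le H simple_root (root_shift \<kappa> z) (root_shift \<kappa> w)"
    unfolding root_le_def
    by (intro exI[of _ "\<lambda>i. nat (w i - z i)"])
      (simp add: root_shift_def sum_subtractf left_diff_distrib)
qed

lemma root_shift_root_shift: "root_shift (root_shift \<kappa> z) w = root_shift \<kappa> (\<lambda>j. z j + w j)"
  by (auto simp: root_shift_def fun_eq_iff sum.distrib algebra_simps)

lemma root_shift_0: "\<kappa> \<in> linear_dual scaleC H \<Longrightarrow> root_shift \<kappa> (\<lambda>_. 0) = \<kappa>"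
  by (auto simp: root_shift_def linear_dual_def fun_eq_iff extensional_def)

lemma root_shift_of_root_le:
  assumes "\<mu> \<in> linear_dual scaleC H" "\<nu> \<in> linear_dual scaleC H" "root_le H simple_root \<mu> \<nu>"
  obtains z where "\<nu> = root_shift \<mu> z"
proof -
  obtain k :: "'i \<Rightarrow> nat" where
    k: "\<And>x. x \<in> H \<Longrightarrow> \<nu> x - \<mu> x = (\<Sum>i\<in>UNIV. of_nat (k i) * simple_root i x)"
    using assms(3) unfolding root_le_def by blast
  have "\<nu> = root_shift \<mu> (\<lambda>i. int (k i))"
    using assms(2) by (auto simp: root_shift_def linear_dual_def extensional_def fun_eq_iff
        simp flip: k)
  then show thesis by (rule that)
qed

lemma comparability_root_shift:
  assumes "(\<mu>, \<nu>) \<in> comparability dominance"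
  obtains z where "\<nu> = root_shift \<mu> z"
proof -
  have dual: "\<mu> \<in> linear_dual scaleC H" "\<nu> \<in> linear_dual scaleC H"
    using assms by (auto simp: comparability_def dominance_poset_def dominant_weights_def)
  consider "root_le H simple_root \<mu> \<nu>" | "root_le H simple_root \<nu> \<mu>"
    using assms by (auto simp: comparability_def dominance_poset_def)
  then show thesis
  proof cases
    case 1
    then show thesis using root_shift_of_root_le[OF dual] that by blast
  next
    case 2
    then obtain z where "\<mu> = root_shift \<nu> z"
      using root_shift_of_root_le[OF dual(2,1)] by blast
    then have "root_shift \<mu> (\<lambda>j. - z j) = \<nu>"
      by (simp add: root_shift_root_shift root_shift_0[OF dual(2)])
    then show thesis using that by metis
  qed
qed

text \<open>A chain of comparisons never leaves the coset of \<kappa>. Conversely, any dominant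
  weight of the coset is joined to \<kappa> by two comparisons through their meet.\<close>

lemma connected_component_root_shift:
  assumes "C \<in> connected_components dominance"
  obtains \<kappa> b where "C = root_shift \<kappa> ` dominant_points A b"
proof -
  obtain \<kappa> where \<kappa>: "\<kappa> \<in> dominant_weights scaleC H simple_coroot"
    and C: "C = (comparability dominance)\<^sup>+ `` {\<kappa>}"
    using assms unfolding connected_components_def
    by (auto simp: dominance_poset_def elim: quotientE)
  then have dual: "\<kappa> \<in> linear_dual scaleC H"
    by (simp add: dominant_weights_def)
  have "\<exists>k. \<kappa> (simple_coroot i) = of_int k" for i
    using \<kappa> unfolding dominant_weights_def by (force elim: Nats_cases intro: exI[of _ "int _"])
  then obtain b where b: "\<And>i. \<kappa> (simple_coroot i) = of_int (b i)"
    by metis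
  note dominant_iff = root_shift_dominant_iff[OF dual b]
  have zero: "(\<lambda>_. 0) \<in> dominant_points A b"
    using \<kappa> dominant_iff root_shift_0[OF dual] by metis
  have comp: "(root_shift \<kappa> z, root_shift \<kappa> w) \<in> comparability dominance"
    if "z \<in> dominant_points A b" "w \<in> dominant_points A b" "z \<le> w \<or> w \<le> z" for z w
    using that by (simp add: comparability_def dominance_poset_def dominant_iff
        root_le_root_shift_iff)
  have "C = root_shift \<kappa> ` dominant_points A b"
  proof (intro equalityI subsetI)
    fix \<nu> assume "\<nu> \<in> C"
    then have "(\<kappa>, \<nu>) \<in> (comparability dominance)\<^sup>+"
      using C by simp
    then obtain z where z: "\<nu> = root_shift \<kappa> z"
    \<comment> \<open>Coordinates add up along the chain.\<close>
    proof (induction arbitrary: thesis rule: trancl_induct)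
      case (base \<nu>)
      then show ?case using comparability_root_shift by metis
    next
      case (step \<mu> \<nu>)
      then show ?case using comparability_root_shift root_shift_root_shift by metis
    qed
    \<comment> \<open>The last link of the chain already has its endpoint in the carrier.\<close>
    have "\<nu> \<in> dominant_weights scaleC H simple_coroot"
      using \<open>(\<kappa>, \<nu>) \<in> (comparability dominance)\<^sup>+\<close>
      by (cases rule: tranclE) (auto simp: comparability_def dominance_poset_def)
    then show "\<nu> \<in> root_shift \<kappa> ` dominant_points A b"
      using z dominant_iff by blast
  next
    fix \<nu> assume "\<nu> \<in> root_shift \<kappa> ` dominant_points A b"
    then obtain z where z: "z \<in> dominant_points A b" "\<nu> = root_shift \<kappa> z"
      by blast
    let ?m = "inf (\<lambda>_. 0) z"
    have "?m \<in> dominant_points A b"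
      by (rule inf_dominant_points[OF gcm zero z(1)])
    then have "(\<kappa>, root_shift \<kappa> ?m) \<in> comparability dominance"
      "(root_shift \<kappa> ?m, \<nu>) \<in> comparability dominance"
      using comp[OF zero, of ?m] comp[OF _ z(1), of ?m] by (auto simp: root_shift_0[OF dual] z(2))
    then show "\<nu> \<in> C"
      unfolding C by (auto intro: trancl_into_trancl)
  qed
  then show thesis by (rule that)
qed

end

section \<open>Transport of the lattice structure to a component\<close>

lemma lattice_transfer:
  fixes L :: "'a gorder" and g :: "'b :: order \<Rightarrow> 'a"
  assumes carrier: "carrier L = g ` D" and eq: "eq L = (=)"
    and le: "\<And>x y. x \<in> D \<Longrightarrow> y \<in> D \<Longrightarrow> g x \<sqsubseteq>\<^bsub>L\<^esub> g y \<longleftrightarrow> x \<le> y"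
    and join: "\<And>x y. x \<in> D \<Longrightarrow> y \<in> D \<Longrightarrow>
      \<exists>s\<in>D. x \<le> s \<and> y \<le> s \<and> (\<forall>t\<in>D. x \<le> t \<longrightarrow> y \<le> t \<longrightarrow> s \<le> t)"
    and meet: "\<And>x y. x \<in> D \<Longrightarrow> y \<in> D \<Longrightarrow>
      \<exists>s\<in>D. s \<le> x \<and> s \<le> y \<and> (\<forall>t\<in>D. t \<le> x \<longrightarrow> t \<le> y \<longrightarrow> t \<le> s)"
  shows "lattice L"
proof unfold_locales
  fix x y assume "x \<in> carrier L" "y \<in> carrier L"
  then obtain p q where pq: "x = g p" "y = g q" "p \<in> D" "q \<in> D"
    using carrier by auto
  obtain s where s: "s \<in> D" "p \<le> s" "q \<le> s" "\<And>t. t \<in> D \<Longrightarrow> p \<le> t \<Longrightarrow> q \<le> t \<Longrightarrow> s \<le> t"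
    using join[OF pq(3,4)] by blast
  \<comment> \<open>Every upper bound in \<open>L\<close> has the form \<open>g t\<close> with
    \<open>t\<close> in \<open>D\<close>, so \<open>le\<close> reduces the claim to the choice of
    \<open>s\<close>.\<close>
  have "least L (g s) (Upper L {x, y})"
    using s pq by (auto simp: least_def Upper_def carrier le)
  then show "\<exists>s. least L s (Upper L {x, y})" ..
  obtain m where m: "m \<in> D" "m \<le> p" "m \<le> q" "\<And>t. t \<in> D \<Longrightarrow> t \<le> p \<Longrightarrow> t \<le> q \<Longrightarrow> t \<le> m"
    using meet[OF pq(3,4)] by blast
  have "greatest L (g m) (Lower L {x, y})"
    using m pq by (auto simp: greatest_def Lower_def carrier le)
  then show "\<exists>s. greatest L s (Lower L {x, y})" ..
\<comment> \<open>The order axioms are pulled back along \<open>le\<close>; antisymmetry in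
  \<open>'b\<close> gives equal arguments and hence equal images.\<close>
qed (use eq in \<open>auto simp: carrier le\<close>)

theorem lemma2:
  fixes A :: "int ^ 'i ^ 'i"
    and scaleC :: "complex \<Rightarrow> 'g :: ab_group_add \<Rightarrow> 'g"
    and bracket :: "'g \<Rightarrow> 'g \<Rightarrow> 'g"
    and H :: "'g set"
    and simple_root :: "'i \<Rightarrow> 'g \<Rightarrow> complex"
    and simple_coroot e f :: "'i \<Rightarrow> 'g"
  assumes "affine_gcm A"
    and "kac_moody_algebra A scaleC bracket H simple_root simple_coroot e f"
  shows "\<forall>C \<in> connected_components (dominance_poset scaleC H simple_root simple_coroot).
           lattice (dominance_poset scaleC H simple_root simple_coroot\<lparr>carrier := C\<rparr>)"
proof
  interpret kac_moody_algebra A scaleC bracket H simple_root simple_coroot e f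
    by (rule assms(2))
  fix C assume "C \<in> connected_components dominance"
  then obtain \<kappa> b where C: "C = root_shift \<kappa> ` dominant_points A b"
    by (rule connected_component_root_shift)
  show "lattice (dominance\<lparr>carrier := C\<rparr>)"
  proof (rule lattice_transfer[where g = "root_shift \<kappa>" and D = "dominant_points A b"])
    fix z w assume zw: "z \<in> dominant_points A b" "w \<in> dominant_points A b"
    show "root_shift \<kappa> z \<sqsubseteq>\<^bsub>dominance\<lparr>carrier := C\<rparr>\<^esub> root_shift \<kappa> w \<longleftrightarrow> z \<le> w"
      by (simp add: dominance_poset_def root_le_root_shift_iff)
    show "\<exists>s\<in>dominant_points A b. z \<le> s \<and> w \<le> s \<and>
        (\<forall>t\<in>dominant_points A b. z \<le> t \<longrightarrow> w \<le> t \<longrightarrow> s \<le> t)"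
      using dominant_points_join[OF assms(1) zw(1), of w] by metis
    show "\<exists>s\<in>dominant_points A b. s \<le> z \<and> s \<le> w \<and>
        (\<forall>t\<in>dominant_points A b. t \<le> z \<longrightarrow> t \<le> w \<longrightarrow> t \<le> s)"
      using inf_dominant_points[OF gcm zw] by (intro bexI[of _ "inf z w"]) auto
  qed (auto simp: C dominance_poset_def)
qed

end
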